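(* Let $E\in C^3(\mathbb{R}^d,\mathbb{R})$, let $x^*$ be an index-$k$ saddle point of $E$, let $\delta>0$ and $U(x^*,\delta)=\{x\in\mathbb{R}^d : \|x-x^*\|_2<\delta\}$. Assume: (a) there is a constant $M>0$ such that $\|\nabla^2E(x)-\nabla^2E(y)\|_2\leqslant M\|x-y\|_2$ for all $x,y\in U(x^*,\delta)$; (b) there are constants $0<\epsilon<\mu<L$ such that for every $x\in U(x^*,\delta)$ the eigenvalues $\lambda_1\leqslant\dots\leqslant\lambda_d$ of $\nabla^2E(x)$ satisfy $\lambda_1\leqslant\dots\leqslant\lambda_k<0<\lambda_{k+1}\leqslant\dots\leqslant\lambda_d$, $|\lambda_i|\in[\epsilon,L]$ for $1\leqslant i\leqslant k$, and $|\lambda_i|\in[\mu,L]$ for $k+1\leqslant i\leqslant d$. For $\alpha\in(0,1)$ let $\kappa=L/\mu$ and $$p(\alpha)=\left(\frac52+\frac{27\mu}{2\epsilon}\right)\alpha+\left(\frac{3\mu}{\epsilon}+\frac12\right)\alpha^2,\qquad b(\alpha)=(2-\alpha-\alpha^2)L+3(2-\alpha)\mu,$$ $$q(\alpha)=\frac{(4-2\alpha)\mu-(2\alpha+4p(\alpha))L}{b(\alpha)},\qquad c(\alpha)=\frac{6M\mu}{b(\alpha)\epsilon}.$$ Let $(x^{(n)})_{n\geqslant0}$ be generated by $$x^{(n+1)} = x^{(n)} - \beta_n \left( I - \sum_{i=1}^{k}\left(1+\frac{\eta_n}{|\alpha_i^{(n)}|}\right) v_i^{(n)} v_i^{(n)\top}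 \right) \nabla E(x^{(n)}),\qquad \alpha_i^{(n)}=v_i^{(n)\top}\nabla^2E(x^{(n)})v_i^{(n)},$$ with $\beta_n=\frac{4}{b(\alpha)}$ and $\eta_n=\frac32\mu$ for all $n\geqslant0$, where for each $n$ the vectors $v_1^{(n)},\dots,v_k^{(n)}\in\mathbb{R}^d$ are orthonormal. For each $n$ let $u_1^{(n)},\dots,u_d^{(n)}$ be orthonormal eigenvectors of $\nabla^2E(x^{(n)})$ corresponding to its eigenvalues sorted in ascending order, and assume that for all $n\geqslant0$ $$\left\|u_i^{(n)}-v_i^{(n)}\right\|_2\leqslant\frac{\alpha}{\sqrt k},\qquad i=1,\dots,k,$$ where $\alpha\in(0,1)$ satisfies $$\alpha\leqslant\sqrt{\frac{k\epsilon}{2(L+\epsilon)}},\qquad \alpha+\kappa\,(\alpha+2p(\alpha))<2.$$ If the initial guess satisfies $$r_0=\|x^{(0)}-x^*\|_2<\min\{\delta,\hat r\},\qquad \hat r=\frac{q(\alpha)}{c(\alpha)},$$ then $x^{(n)}$ converges to $x^*$ as $n\to\infty$ with a linear convergence rate: for all $n\geqslant0$, $$r_n=\|x^{(n)}-x^*\|_2\leqslant\left(\frac{1}{1+q(\alpha)}\right)^n\frac{\hat r\,r_0}{\hat r-r_0}.$$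
   Context: A point $x^*$ is an index-$k$ saddle point of $E$ if $\nabla E(x^* )=0$ and $\nabla^2E(x^* )$ has exactly $k$ negative eigenvalues; it is assumed nondegenerate, i.e. $\nabla^2E(x^* )$ has no zero eigenvalue. $\|\cdot\|_2$ is the Euclidean norm for vectors and the induced operator norm for matrices. Eigenvalues are counted with multiplicity. Note that the constant $\alpha$ (eigenvector error bound) is distinct from the Rayleigh quotients $\alpha_i^{(n)}$. *)

theory Defs
  imports "HOL-Analysis.Analysis" "HOL-Computational_Algebra.Polynomial"
begin

definition partial_deriv :: "'n \<Rightarrow> (real ^ 'n \<Rightarrow> real) \<Rightarrow> real ^ 'n \<Rightarrow> real"
  where "partial_deriv i f x = frechet_derivative f (at x) (axis i 1)"

text \<open>\<open>C_k m f\<close> says that \<open>f\<close> is of class \<open>C\<^sup>m\<close> on the whole space. The Frechet derivative is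
  total, so differentiability has to be required explicitly.\<close>

primrec C_k :: "nat \<Rightarrow> (real ^ 'n \<Rightarrow> real) \<Rightarrow> bool"
  where
    "C_k 0 f \<longleftrightarrow> continuous_on UNIV f"
  | "C_k (Suc m) f \<longleftrightarrow> f differentiable_on UNIV \<and> (\<forall>i. C_k m (partial_deriv i f))"

definition gradient :: "(real ^ 'n \<Rightarrow> real) \<Rightarrow> real ^ 'n \<Rightarrow> real ^ 'n"
  where "gradient f x = (\<chi> i. partial_deriv i f x)"

definition hessian :: "(real ^ 'n \<Rightarrow> real) \<Rightarrow> real ^ 'n \<Rightarrow> real ^ 'n ^ 'n"
  where "hessian f x = (\<chi> i j. partial_deriv i (partial_deriv j f) x)"

definition matrix_norm2 :: "real ^ 'n ^ 'm \<Rightarrow> real"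
  where "matrix_norm2 A = onorm (\<lambda>v. A *v v)"

definition charpoly :: "real ^ 'n ^ 'n \<Rightarrow> real poly"
  where "charpoly A = det (\<chi> i j. (if i = j then [:0, 1:] else 0) - [:A $ i $ j:])"

text \<open>Real eigenvalues with algebraic multiplicity; for a symmetric matrix these are all
  \<open>CARD('n)\<close> eigenvalues. \<open>nth_eigenvalue A i\<close> is the \<open>i\<close>-th smallest of them, counted from
  \<open>i = 1\<close>, and is meaningful for \<open>1 \<le> i \<le> CARD('n)\<close> only.\<close>

definition eigenvalues :: "real ^ 'n ^ 'n \<Rightarrow> real multiset"
  where "eigenvalues A = proots (charpoly A)"

definition nth_eigenvalue :: "real ^ 'n ^ 'n \<Rightarrow> nat \<Rightarrow> real"
  where "nth_eigenvalue A i = sorted_list_of_multiset (eigenvalues A) ! (i - 1)"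

text \<open>Saddle points are nondegenerate by convention.\<close>

definition index_saddle :: "nat \<Rightarrow> (real ^ 'n \<Rightarrow> real) \<Rightarrow> real ^ 'n \<Rightarrow> bool"
  where "index_saddle k f z \<longleftrightarrow>
    gradient f z = 0 \<and>
    size {#t \<in># eigenvalues (hessian f z). t < 0#} = k \<and>
    0 \<notin># eigenvalues (hessian f z)"

definition orthonormal_upto :: "nat \<Rightarrow> (nat \<Rightarrow> real ^ 'n) \<Rightarrow> bool"
  where "orthonormal_upto m v \<longleftrightarrow>
    (\<forall>i\<in>{1..m}. \<forall>j\<in>{1..m}. v i \<bullet> v j = (if i = j then 1 else 0))"

definition outer_product :: "real ^ 'm \<Rightarrow> real ^ 'n \<Rightarrow> real ^ 'n ^ 'm"
  where "outer_product v w = (\<chi> i j. v $ i * w $ j)"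

definition rate_p :: "real \<Rightarrow> real \<Rightarrow> real \<Rightarrow> real"
  where "rate_p \<epsilon> \<mu> \<alpha> =
    (5 / 2 + 27 * \<mu> / (2 * \<epsilon>)) * \<alpha> + (3 * \<mu> / \<epsilon> + 1 / 2) * \<alpha>\<^sup>2"

definition rate_b :: "real \<Rightarrow> real \<Rightarrow> real \<Rightarrow> real"
  where "rate_b \<mu> L \<alpha> = (2 - \<alpha> - \<alpha>\<^sup>2) * L + 3 * (2 - \<alpha>) * \<mu>"

definition rate_q :: "real \<Rightarrow> real \<Rightarrow> real \<Rightarrow> real \<Rightarrow> real"
  where "rate_q \<epsilon> \<mu> L \<alpha> =
    ((4 - 2 * \<alpha>) * \<mu> - (2 * \<alpha> + 4 * rate_p \<epsilon> \<mu> \<alpha>) * L) / rate_b \<mu> L \<alpha>"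

definition rate_c :: "real \<Rightarrow> real \<Rightarrow> real \<Rightarrow> real \<Rightarrow> real \<Rightarrow> real"
  where "rate_c M \<epsilon> \<mu> L \<alpha> = 6 * M * \<mu> / (rate_b \<mu> L \<alpha> * \<epsilon>)"

definition rate_radius :: "real \<Rightarrow> real \<Rightarrow> real \<Rightarrow> real \<Rightarrow> real \<Rightarrow> real"
  where "rate_radius M \<epsilon> \<mu> L \<alpha> = rate_q \<epsilon> \<mu> L \<alpha> / rate_c M \<epsilon> \<mu> L \<alpha>"

end

theory Submission
  imports Defs
begin

text \<open>With exact eigenvectors, \<open>I - \<beta> P H\<close> is diagonal in the eigenbasis of the Hessian \<open>H\<close> at the
  current iterate: negative eigenvalues turn into \<open>1 - \<beta> \<eta>\<close> and a positive one \<open>\<lambda>\<close> into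
  \<open>1 - \<beta> \<lambda>\<close>. Replacing the eigenvectors by the \<open>v\<^sub>i\<close> perturbs \<open>P\<close> by \<open>O(\<alpha>)\<close>, because
  \<open>v v\<^sup>T - u u\<^sup>T = v (v - u)\<^sup>T + (v - u) u\<^sup>T\<close>, and each Rayleigh quotient differs from its
  eigenvalue only by \<open>O(L \<alpha>\<^sup>2)\<close>. Together with \<open>\<nabla>E(x) = H (x - x\<^sup>*) + O(M r\<^sup>2)\<close> this gives
  \<open>r\<^sub>n\<^sub>+\<^sub>1 \<le> (1 - q + c r\<^sub>n) r\<^sub>n\<close>.
  The condition on \<open>\<kappa>\<close> forces \<open>27 L \<alpha> \<le> 2 \<epsilon>\<close>, which keeps the Rayleigh quotients away from \<open>0\<close>.\<close>

section \<open>Finite orthonormal families\<close>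

lemma orthonormal_upto_mono: "orthonormal_upto m v \<Longrightarrow> k \<le> m \<Longrightarrow> orthonormal_upto k v"
  unfolding orthonormal_upto_def by auto

lemma inner_partial_sum_orthonormal:
  assumes "orthonormal_upto m u" "k \<le> m" "i \<in> {1..m}"
  shows "u i \<bullet> (\<Sum>j=1..k. c j *\<^sub>R u j) = (if i \<le> k then c i else 0)"
proof -
  have "u i \<bullet> (\<Sum>j=1..k. c j *\<^sub>R u j) = (\<Sum>j=1..k. if j = i then c j else 0)"
    using assms unfolding inner_sum_right orthonormal_upto_def by (intro sum.cong) auto
  then show ?thesis
    using assms by simp
qed

lemma inner_sum_orthonormal:
  assumes "orthonormal_upto k v" "i \<in> {1..k}"
  shows "v i \<bullet> (\<Sum>j=1..k. c j *\<^sub>R v j) = c i"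
  using inner_partial_sum_orthonormal[OF assms(1) order_refl assms(2)] assms(2) by simp

lemma norm_sum_orthonormal:
  assumes "orthonormal_upto k v"
  shows "norm (\<Sum>i=1..k. c i *\<^sub>R v i) = L2_set c {1..k}"
proof -
  have "(norm (\<Sum>i=1..k. c i *\<^sub>R v i))\<^sup>2 = (\<Sum>i=1..k. c i * (v i \<bullet> (\<Sum>j=1..k. c j *\<^sub>R v j)))"
    unfolding power2_norm_eq_inner by (subst inner_sum_left) simp
  also have "\<dots> = (\<Sum>i=1..k. (c i)\<^sup>2)"
    using inner_sum_orthonormal[OF assms, of _ c] by (intro sum.cong) (auto simp: power2_eq_square)
  finally show ?thesis
    unfolding L2_set_def by (metis norm_ge_zero real_sqrt_unique)
qed

text \<open>Pythagoras: the residual is orthogonal to the projection. Both Bessel's inequality and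
  the fact that removing the projection never increases the norm follow from it.\<close>

lemma norm_diff_orthonormal_projection:
  assumes "orthonormal_upto k v"
  shows "(norm (y - (\<Sum>i=1..k. (v i \<bullet> y) *\<^sub>R v i)))\<^sup>2 = (norm y)\<^sup>2 - (L2_set (\<lambda>i. v i \<bullet> y) {1..k})\<^sup>2"
proof -
  let ?s = "\<Sum>i=1..k. (v i \<bullet> y) *\<^sub>R v i"
  have "?s \<bullet> y = (\<Sum>i=1..k. (v i \<bullet> y)\<^sup>2)"
    by (simp add: inner_sum_left power2_eq_square)
  also have "\<dots> = (norm ?s)\<^sup>2"
    unfolding norm_sum_orthonormal[OF assms] L2_set_def by (simp add: sum_nonneg)
  finally have "(norm (y - ?s))\<^sup>2 = (norm y)\<^sup>2 - (norm ?s)\<^sup>2"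
    by (simp add: power2_norm_eq_inner inner_diff_left inner_diff_right inner_commute)
  then show ?thesis
    using norm_sum_orthonormal[OF assms] by simp
qed

lemma norm_diff_orthonormal_projection_le:
  assumes "orthonormal_upto k v"
  shows "norm (y - (\<Sum>i=1..k. (v i \<bullet> y) *\<^sub>R v i)) \<le> norm y"
  using norm_diff_orthonormal_projection[OF assms, of y]
  by (auto intro: power2_le_imp_le[OF _ norm_ge_zero])

lemma bessel_inequality:
  assumes "orthonormal_upto k v"
  shows "L2_set (\<lambda>i. v i \<bullet> y) {1..k} \<le> norm y"
proof (rule power2_le_imp_le[OF _ norm_ge_zero])
  have "0 \<le> (norm y)\<^sup>2 - (L2_set (\<lambda>i. v i \<bullet> y) {1..k})\<^sup>2"
    unfolding norm_diff_orthonormal_projection[OF assms, symmetric] by (rule zero_le_power2)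
  then show "(L2_set (\<lambda>i. v i \<bullet> y) {1..k})\<^sup>2 \<le> (norm y)\<^sup>2"
    by linarith
qed

lemma orthonormal_upto_independent:
  assumes "orthonormal_upto k v"
  shows "independent (v ` {1..k})" "card (v ` {1..k}) = k"
proof -
  have o: "v i \<bullet> v j = (if i = j then 1 else 0)" if "i \<in> {1..k}" "j \<in> {1..k}" for i j
    using assms that by (auto simp: orthonormal_upto_def)
  have "inj_on v {1..k}"
  proof (rule inj_onI)
    fix i j assume "i \<in> {1..k}" "j \<in> {1..k}" "v i = v j"
    then show "i = j"
      using o[of i j] o[of i i] by (auto split: if_splits)
  qed
  then show "card (v ` {1..k}) = k"
    by (simp add: card_image)
  have "0 \<notin> v ` {1..k}"
  proof
    assume "0 \<in> v ` {1..k}"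
    then obtain i where "i \<in> {1..k}" "v i = 0"
      by force
    then show False
      using o[of i i] by simp
  qed
  moreover have "pairwise orthogonal (v ` {1..k})"
  proof (rule pairwiseI)
    fix x y assume "x \<in> v ` {1..k}" "y \<in> v ` {1..k}" "x \<noteq> y"
    then obtain i j where "i \<in> {1..k}" "j \<in> {1..k}" "x = v i" "y = v j" "i \<noteq> j"
      by blast
    then show "orthogonal x y"
      using o[of i j] by (simp add: orthogonal_def)
  qed
  ultimately show "independent (v ` {1..k})"
    by (rule pairwise_orthogonal_independent[rotated])
qed

lemma orthonormal_upto_le_CARD:
  fixes v :: "nat \<Rightarrow> real ^ 'n"
  assumes "orthonormal_upto k v"
  shows "k \<le> CARD('n)"
  using orthonormal_upto_independent[OF assms] independent_bound[of "v ` {1..k}"] by simp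

lemma orthonormal_expansion:
  fixes u :: "nat \<Rightarrow> real ^ 'n"
  assumes "orthonormal_upto CARD('n) u"
  shows "(\<Sum>i=1..CARD('n). (u i \<bullet> y) *\<^sub>R u i) = y"
proof -
  let ?z = "y - (\<Sum>i=1..CARD('n). (u i \<bullet> y) *\<^sub>R u i)"
  have "orthogonal ?z w" if "w \<in> u ` {1..CARD('n)}" for w
  proof -
    from that obtain i where i: "i \<in> {1..CARD('n)}" "w = u i"
      by blast
    have "w \<bullet> ?z = 0"
      unfolding i(2) inner_diff_right inner_sum_orthonormal[OF assms i(1)] by simp
    then show ?thesis
      by (simp add: orthogonal_def inner_commute)
  qed
  \<comment> \<open>As many independent vectors as the dimension must span. The residual is then
    orthogonal to the whole space, in particular to itself.\<close>
  moreover have "span (u ` {1..CARD('n)}) = UNIV"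
    using orthonormal_upto_independent[OF assms]
      card_ge_dim_independent[of "u ` {1..CARD('n)}" UNIV] by auto
  ultimately have "orthogonal ?z ?z"
    using orthogonal_to_span[of ?z "u ` {1..CARD('n)}" ?z] by simp
  then show ?thesis
    by (simp add: orthogonal_def)
qed

lemma parseval:
  fixes u :: "nat \<Rightarrow> real ^ 'n"
  assumes "orthonormal_upto CARD('n) u"
  shows "norm y = L2_set (\<lambda>i. u i \<bullet> y) {1..CARD('n)}"
  by (metis norm_sum_orthonormal[OF assms, of "\<lambda>i. u i \<bullet> y"] orthonormal_expansion[OF assms, of y])

section \<open>Estimates for weighted sums over orthonormal families\<close>

lemma L2_set_abs: "L2_set (\<lambda>i. \<bar>f i\<bar>) S = L2_set f S"
  unfolding L2_set_def by simp

text \<open>Together with Bessel or Parseval this turns a bound on each coordinate into a norm bound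
  with the same constant, so that no factor depending on the number of coordinates is lost.\<close>

lemma L2_set_scaled_le:
  assumes "\<And>i. i \<in> S \<Longrightarrow> \<bar>f i\<bar> \<le> c * \<bar>g i\<bar>" "0 \<le> c"
  shows "L2_set f S \<le> c * L2_set g S"
proof -
  have "L2_set (\<lambda>i. \<bar>f i\<bar>) S \<le> L2_set (\<lambda>i. c * \<bar>g i\<bar>) S"
    by (rule L2_set_mono) (use assms(1) in blast, simp)
  then show ?thesis
    unfolding L2_set_abs L2_set_right_distrib[OF assms(2), symmetric] .
qed

lemma norm_sum_scaleR_le_L2:
  "norm (\<Sum>i\<in>S. c i *\<^sub>R w i) \<le> L2_set c S * L2_set (\<lambda>i. norm (w i)) S"
proof -
  have "norm (\<Sum>i\<in>S. c i *\<^sub>R w i) \<le> (\<Sum>i\<in>S. \<bar>c i\<bar> * \<bar>norm (w i)\<bar>)"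
    by (rule sum_norm_le) simp
  also have "\<dots> \<le> L2_set c S * L2_set (\<lambda>i. norm (w i)) S"
    by (rule L2_set_mult_ineq)
  finally show ?thesis .
qed

text \<open>This is where the scaling of the eigenvector error by \<open>1 / sqrt k\<close> is used
  up: jointly the \<open>k\<close> errors have size \<open>\<alpha>\<close>. For
  \<open>k = 0\<close> the sum is empty and the bound is just
  \<open>0 \<le> \<alpha>\<close>.\<close>

lemma L2_set_norm_le:
  assumes "\<And>i. i \<in> {1..k} \<Longrightarrow> norm (w i) \<le> \<alpha> / sqrt (real k)" "0 \<le> \<alpha>"
  shows "L2_set (\<lambda>i. norm (w i)) {1..k} \<le> \<alpha>"
proof -
  have "L2_set (\<lambda>i. norm (w i)) {1..k} \<le> \<alpha> / sqrt (real k) * L2_set (\<lambda>i. 1) {1..k}"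
    by (rule L2_set_scaled_le) (use assms in auto)
  also have "\<dots> \<le> \<alpha>"
    using assms(2) by (simp add: L2_set_def)
  finally show ?thesis .
qed

lemma norm_sum_orthonormal_le:
  assumes "orthonormal_upto k v" "\<And>i. i \<in> {1..k} \<Longrightarrow> \<bar>c i\<bar> \<le> a * \<bar>g i\<bar>" "0 \<le> a"
  shows "norm (\<Sum>i=1..k. c i *\<^sub>R v i) \<le> a * L2_set g {1..k}"
  unfolding norm_sum_orthonormal[OF assms(1)] by (rule L2_set_scaled_le[OF assms(2,3)])

text \<open>Each of the two summands in \<open>v (v - u)^T + (v - u) u^T\<close> costs
  \<open>a * \<alpha> * norm h\<close>. In the first the outer vectors are orthonormal, so only the
  coefficients matter. In the second they are not, and Cauchy-Schwarz over the index is combined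
  with Bessel for \<open>u\<close>.\<close>

lemma norm_weighted_projection_diff_le:
  assumes u: "orthonormal_upto k u" and v: "orthonormal_upto k v"
    and w: "\<And>i. i \<in> {1..k} \<Longrightarrow> norm (u i - v i) \<le> \<alpha> / sqrt (real k)"
    and a: "\<And>i. i \<in> {1..k} \<Longrightarrow> \<bar>c i\<bar> \<le> a" and nonneg: "0 \<le> \<alpha>" "0 \<le> a"
  shows "norm ((\<Sum>i=1..k. (c i * (v i \<bullet> h)) *\<^sub>R v i) - (\<Sum>i=1..k. (c i * (u i \<bullet> h)) *\<^sub>R u i))
    \<le> 2 * a * \<alpha> * norm h"
proof -
  let ?w = "\<lambda>i. v i - u i"
  have w': "L2_set (\<lambda>i. norm (?w i)) {1..k} \<le> \<alpha>"
    using w nonneg by (intro L2_set_norm_le) (auto simp: norm_minus_commute)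
  have 1: "norm (\<Sum>i=1..k. (c i * (?w i \<bullet> h)) *\<^sub>R v i) \<le> a * (\<alpha> * norm h)"
  proof -
    have "norm (\<Sum>i=1..k. (c i * (?w i \<bullet> h)) *\<^sub>R v i) \<le> a * L2_set (\<lambda>i. ?w i \<bullet> h) {1..k}"
      using a nonneg by (intro norm_sum_orthonormal_le[OF v]) (auto simp: abs_mult mult_right_mono)
    also have "L2_set (\<lambda>i. ?w i \<bullet> h) {1..k} \<le> norm h * L2_set (\<lambda>i. norm (?w i)) {1..k}"
      by (rule L2_set_scaled_le) (auto simp: Cauchy_Schwarz_ineq2 mult.commute[of "norm h"])
    also have "\<dots> \<le> \<alpha> * norm h"
      using mult_right_mono[OF w', of "norm h"] by (simp add: mult.commute)
    finally show ?thesis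
      using nonneg by (simp add: mult_left_mono)
  qed
  have 2: "norm (\<Sum>i=1..k. (c i * (u i \<bullet> h)) *\<^sub>R ?w i) \<le> a * (\<alpha> * norm h)"
  proof -
    have "L2_set (\<lambda>i. c i * (u i \<bullet> h)) {1..k} \<le> a * L2_set (\<lambda>i. u i \<bullet> h) {1..k}"
      using a nonneg by (intro L2_set_scaled_le) (auto simp: abs_mult mult_right_mono)
    also have "\<dots> \<le> a * norm h"
      using bessel_inequality[OF u] nonneg by (intro mult_left_mono)
    finally have "L2_set (\<lambda>i. c i * (u i \<bullet> h)) {1..k} * L2_set (\<lambda>i. norm (?w i)) {1..k}
        \<le> (a * norm h) * \<alpha>"
      using w' nonneg by (intro mult_mono) auto
    then show ?thesis
      using norm_sum_scaleR_le_L2[of "\<lambda>i. c i * (u i \<bullet> h)" ?w "{1..k}"] by (simp add: mult_ac)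
  qed
  have "(\<Sum>i=1..k. (c i * (v i \<bullet> h)) *\<^sub>R v i) - (\<Sum>i=1..k. (c i * (u i \<bullet> h)) *\<^sub>R u i)
      = (\<Sum>i=1..k. (c i * (?w i \<bullet> h)) *\<^sub>R v i) + (\<Sum>i=1..k. (c i * (u i \<bullet> h)) *\<^sub>R ?w i)"
    by (simp add: algebra_simps flip: sum.distrib sum_subtractf)
  then show ?thesis
    using norm_triangle_mono[OF 1 2] by (simp add: mult_ac)
qed

lemma outer_product_vector: "outer_product v w *v y = (w \<bullet> y) *\<^sub>R v"
  by (simp add: outer_product_def vec_eq_iff matrix_vector_mult_def inner_vec_def sum_distrib_left
      sum_distrib_right mult_ac)

lemma sum_matrix_vector_mult: "(\<Sum>i\<in>S. A i) *v y = (\<Sum>i\<in>S. A i *v (y :: real ^ 'n))"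
  by (induction S rule: infinite_finite_induct) (auto simp: matrix_vector_mult_add_rdistrib)

section \<open>First-order expansion of the gradient\<close>

lemma norm_matrix_vector_le: "norm (A *v y) \<le> matrix_norm2 A * norm (y :: real ^ 'n)"
  unfolding matrix_norm2_def by (rule onorm) (rule matrix_vector_mul_bounded_linear)

text \<open>Pairing the vector \<open>transpose A *v y\<close> with itself moves the transpose over
  to \<open>A\<close>, after which one factor cancels. The Lipschitz hypothesis on the Hessian
  thereby also controls its transpose.\<close>

lemma norm_transpose_vector_le:
  fixes A :: "real ^ 'n ^ 'm"
  shows "norm (transpose A *v y) \<le> matrix_norm2 A * norm y"
proof -
  let ?t = "transpose A *v y"
  have "norm ?t * norm ?t = (y v* A) \<bullet> ?t"
    by (simp add: power2_norm_eq_inner flip: power2_eq_square)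
  also have "\<dots> = y \<bullet> (A *v ?t)"
    by (rule dot_lmul_matrix)
  also have "\<dots> \<le> norm y * norm (A *v ?t)"
    by (rule norm_cauchy_schwarz)
  also have "\<dots> \<le> norm y * (matrix_norm2 A * norm ?t)"
    by (intro mult_left_mono norm_matrix_vector_le) simp
  finally have "norm ?t * norm ?t \<le> (matrix_norm2 A * norm y) * norm ?t"
    by (simp add: mult_ac)
  moreover have "0 \<le> matrix_norm2 A"
    unfolding matrix_norm2_def by (intro onorm_pos_le matrix_vector_mul_bounded_linear)
  ultimately show ?thesis
    by (cases "norm ?t = 0") auto
qed

text \<open>The transpose appears because the row index of \<open>hessian\<close> is the outer derivative; it can be
  dropped only where the Hessian is known to be symmetric.\<close>

lemma gradient_has_derivative:
  assumes "\<And>j. partial_deriv j E differentiable (at y)"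
  shows "(gradient E has_derivative (\<lambda>h. transpose (hessian E y) *v h)) (at y)"
proof -
  have "((\<lambda>z. gradient E z $ j) has_derivative (\<lambda>h. (transpose (hessian E y) *v h) $ j)) (at y)" for j
  proof -
    let ?D = "frechet_derivative (partial_deriv j E) (at y)"
    have D: "(partial_deriv j E has_derivative ?D) (at y)"
      using assms by (simp add: frechet_derivative_works)
    interpret linear ?D
      using D by (rule has_derivative_linear)
    have "?D = (\<lambda>h. (transpose (hessian E y) *v h) $ j)"
    proof
      fix h
      have "?D h = ?D (\<Sum>i\<in>UNIV. h $ i *\<^sub>R axis i 1)"
        using basis_expansion[of h] by (simp add: scalar_mult_eq_scaleR)
      also have "\<dots> = (\<Sum>i\<in>UNIV. h $ i *\<^sub>R ?D (axis i 1))"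
        by (simp add: sum scale)
      finally show "?D h = (transpose (hessian E y) *v h) $ j"
        by (simp add: matrix_vector_mult_def transpose_def hessian_def partial_deriv_def mult.commute)
    qed
    then show ?thesis
      using D by (simp add: gradient_def)
  qed
  then show ?thesis
    by (subst has_derivative_componentwise_within) (auto simp: Basis_vec_def inner_axis)
qed

text \<open>Mean value inequality along the segment from \<open>xs\<close> to \<open>y\<close>. The
  Hessian is frozen at the far end \<open>y\<close>, because that is the one available at the
  current iterate; at parameter \<open>t\<close> the remaining distance to \<open>y\<close> is
  \<open>(1 - t) * norm e\<close>.\<close>

lemma gradient_expansion_bound:
  assumes diff: "\<And>j y. partial_deriv j E differentiable (at y)"
    and lipschitz: "\<And>y z. y \<in> ball xs \<delta> \<Longrightarrow> z \<in> ball xs \<delta> \<Longrightarrow>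
          matrix_norm2 (hessian E y - hessian E z) \<le> M * norm (y - z)"
    and y: "y \<in> ball xs \<delta>"
  shows "norm (gradient E y - gradient E xs - transpose (hessian E y) *v (y - xs))
    \<le> M / 2 * (norm (y - xs))\<^sup>2"
proof -
  define e where "e = y - xs"
  let ?p = "\<lambda>t. xs + t *\<^sub>R e"
  let ?f = "\<lambda>t. gradient E (?p t) - t *\<^sub>R (transpose (hessian E y) *v e)"
  let ?f' = "\<lambda>t. transpose (hessian E (?p t)) *v e - transpose (hessian E y) *v e"
  \<comment> \<open>An antiderivative of the bound \<open>M * (norm e)\<^sup>2 * (1 - t)\<close>;
    its increment over \<open>{0..1}\<close> yields the factor \<open>1 / 2\<close>.\<close>
  let ?\<phi> = "\<lambda>t. M * (norm e)\<^sup>2 * (t - t\<^sup>2 / 2)"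
  have f': "(?f has_vector_derivative ?f' t) (at t)" for t
  proof -
    have "((\<lambda>t. ?p t) has_derivative (\<lambda>h. h *\<^sub>R e)) (at t)"
      by (auto intro!: derivative_eq_intros)
    then have "((\<lambda>t. gradient E (?p t)) has_derivative
        (\<lambda>h. transpose (hessian E (?p t)) *v (h *\<^sub>R e))) (at t)"
      using gradient_has_derivative[OF diff, of "?p t"] by (rule has_derivative_compose)
    then have "((\<lambda>t. gradient E (?p t)) has_vector_derivative transpose (hessian E (?p t)) *v e) (at t)"
      by (simp add: has_vector_derivative_def matrix_vector_mult_scaleR)
    then show ?thesis
      by (auto intro!: derivative_eq_intros)
  qed
  have "norm (?f 1 - ?f 0) \<le> ?\<phi> 1 - ?\<phi> 0"
  proof (rule differentiable_bound_general[OF zero_less_one])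
    show "continuous_on {0..1} ?f"
      by (intro continuous_at_imp_continuous_on ballI has_vector_derivative_continuous[OF f'])
    show "(?f has_vector_derivative ?f' t) (at t)" for t
      by (rule f')
    show "continuous_on {0..1} ?\<phi>"
      by (intro continuous_intros) auto
    show "(?\<phi> has_vector_derivative M * (norm e)\<^sup>2 * (1 - t)) (at t)" for t
      by (auto intro!: derivative_eq_intros simp flip: has_real_derivative_iff_has_vector_derivative)
    show "norm (?f' t) \<le> M * (norm e)\<^sup>2 * (1 - t)" if t: "0 < t" "t < 1" for t
    proof -
      have "norm (t *\<^sub>R e) \<le> norm e"
        using t by (simp add: mult_left_le_one_le)
      then have "?p t \<in> ball xs \<delta>"
        using y by (simp add: dist_norm e_def norm_minus_commute)
      then have "matrix_norm2 (hessian E (?p t) - hessian E y) \<le> M * norm (?p t - y)"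
        using lipschitz y by blast
      also have "?p t - y = - ((1 - t) *\<^sub>R e)"
        by (simp add: e_def algebra_simps)
      finally have *: "matrix_norm2 (hessian E (?p t) - hessian E y) \<le> M * ((1 - t) * norm e)"
        using t by simp
      have "?f' t = transpose (hessian E (?p t) - hessian E y) *v e"
        by (simp add: transpose_def vec_eq_iff matrix_vector_mult_def left_diff_distrib sum_subtractf)
      then have "norm (?f' t) \<le> matrix_norm2 (hessian E (?p t) - hessian E y) * norm e"
        by (metis norm_transpose_vector_le)
      also have "\<dots> \<le> M * ((1 - t) * norm e) * norm e"
        using * by (rule mult_right_mono) simp
      finally show ?thesis
        by (simp add: power2_eq_square mult_ac)
    qed
  qed
  then show ?thesis
    by (simp add: e_def algebra_simps)
qed

section \<open>One step with inexact eigenvectors\<close>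

lemma rate_b_pos:
  assumes "0 < \<mu>" "0 < L" "0 < \<alpha>" "\<alpha> < 1"
  shows "0 < rate_b \<mu> L \<alpha>"
proof -
  have "\<alpha>\<^sup>2 < 1"
    using assms by (simp add: power_less_one_iff)
  then have "0 < (2 - \<alpha> - \<alpha>\<^sup>2) * L" "0 < 3 * (2 - \<alpha>) * \<mu>"
    using assms by simp_all
  then show ?thesis
    unfolding rate_b_def by linarith
qed

text \<open>Here \<open>t\<close> is an effective eigenvalue: \<open>3 / 2 * \<mu>\<close> on
  reflected directions, an eigenvalue in \<open>{\<mu>..L}\<close> on the others. The last
  subtracted term reserves room for the eigenvector error of \<open>reflect_diff_le\<close>, so that
  their sum is \<open>1 - q\<close>.\<close>

lemma contraction_factor_le:
  fixes \<epsilon> \<mu> L \<alpha> t :: real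
  defines "b \<equiv> rate_b \<mu> L \<alpha>"
  assumes const: "0 < \<epsilon>" "\<epsilon> \<le> \<mu>" "\<mu> \<le> L" "0 < \<alpha>" "\<alpha> < 1"
    and t: "t = 3 / 2 * \<mu> \<or> \<mu> \<le> t \<and> t \<le> L"
  shows "\<bar>1 - 4 / b * t\<bar> \<le> 1 - rate_q \<epsilon> \<mu> L \<alpha>
    - 4 / b * (2 * (1 + 2 * \<mu> / \<epsilon>) * \<alpha> * L + 4 * \<mu> / \<epsilon> * \<alpha>\<^sup>2 * L)"
proof -
  define N where "N = (4 - 2 * \<alpha>) * \<mu> - (2 * \<alpha> + 4 * rate_p \<epsilon> \<mu> \<alpha>) * L"
  define D where "D = 2 * (1 + 2 * \<mu> / \<epsilon>) * \<alpha> * L + 4 * \<mu> / \<epsilon> * \<alpha>\<^sup>2 * L"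
  have "b > 0"
    unfolding b_def by (rule rate_b_pos) (use const in auto)
  \<comment> \<open>With the monomials as atoms, the claim multiplied by \<open>b\<close> is linear.
    The term \<open>54 * B1\<close> in \<open>N\<close> absorbs the \<open>B1\<close> and
    \<open>B2\<close> terms of \<open>4 * D\<close>, because \<open>B2 \<le> B1\<close>.\<close>
  define A1 A2 B1 B2 C where "A1 = \<alpha> * L" and "A2 = \<alpha>\<^sup>2 * L"
    and "B1 = \<mu> / \<epsilon> * \<alpha> * L" and "B2 = \<mu> / \<epsilon> * \<alpha>\<^sup>2 * L" and "C = \<alpha> * \<mu>"
  note defs = A1_def A2_def B1_def B2_def C_def
  have "\<alpha>\<^sup>2 \<le> \<alpha>"
    using const by (simp add: power2_eq_square mult_left_le_one_le)
  then have "B2 \<le> B1"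
    unfolding defs using const by (intro mult_right_mono mult_left_mono) auto
  moreover have "0 \<le> A2" "A2 \<le> A1" "A1 \<le> L" "0 \<le> B2" "0 \<le> C" "C \<le> A1" "C \<le> \<mu>"
    unfolding defs using const \<open>\<alpha>\<^sup>2 \<le> \<alpha>\<close>
    by (auto intro!: mult_right_mono mult_left_mono simp: mult_left_le_one_le)
  moreover have "b = 2 * L - A1 - A2 + 6 * \<mu> - 3 * C"
    by (simp add: b_def rate_b_def defs algebra_simps)
  moreover have "N = 4 * \<mu> - 2 * C - 2 * A1 - (10 * A1 + 54 * B1 + 12 * B2 + 2 * A2)"
    by (simp add: N_def rate_p_def defs algebra_simps)
  moreover have "D = 2 * A1 + 4 * B1 + 4 * B2"
    by (simp add: D_def defs algebra_simps)
  ultimately have "\<bar>b - 4 * t\<bar> \<le> b - N - 4 * D"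
    using t const by (elim disjE) linarith+
  then have "\<bar>b - 4 * t\<bar> / b \<le> (b - N - 4 * D) / b"
    using \<open>b > 0\<close> by (intro divide_right_mono) auto
  moreover have "\<bar>b - 4 * t\<bar> / b = \<bar>1 - 4 / b * t\<bar>"
  proof -
    have "\<bar>b - 4 * t\<bar> / b = \<bar>(b - 4 * t) / b\<bar>"
      using \<open>b > 0\<close> by simp
    then show ?thesis
      using \<open>b > 0\<close> by (simp add: diff_divide_distrib)
  qed
  moreover have "rate_q \<epsilon> \<mu> L \<alpha> = N / b"
    by (simp add: rate_q_def N_def b_def)
  ultimately show ?thesis
    using \<open>b > 0\<close> unfolding D_def[symmetric] by (simp add: diff_divide_distrib)
qed

text \<open>The data of a single iterate, with Hessian \<open>H\<close>. Symmetry of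
  \<open>H\<close> is a consequence of the orthonormal eigenbasis, see
  \<open>transpose_H\<close>.\<close>

locale approx_eigenframe =
  fixes H :: "real ^ 'n ^ 'n" and u v :: "nat \<Rightarrow> real ^ 'n" and lam :: "nat \<Rightarrow> real"
    and k :: nat and \<epsilon> \<mu> L \<alpha> :: real
  assumes u: "orthonormal_upto CARD('n) u" and v: "orthonormal_upto k v"
    and eigenvector: "\<And>i. i \<in> {1..CARD('n)} \<Longrightarrow> H *v u i = lam i *\<^sub>R u i"
    and lam_neg: "\<And>i. i \<in> {1..k} \<Longrightarrow> lam i \<in> {-L..-\<epsilon>}"
    and lam_pos: "\<And>i. i \<in> {k+1..CARD('n)} \<Longrightarrow> lam i \<in> {\<mu>..L}"
    and error: "\<And>i. i \<in> {1..k} \<Longrightarrow> norm (u i - v i) \<le> \<alpha> / sqrt (real k)"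
    and const: "0 < \<epsilon>" "\<epsilon> < \<mu>" "\<mu> < L" and alpha: "0 < \<alpha>" "\<alpha> < 1"
    and alpha_small: "27 * (L * \<alpha>) \<le> 2 * \<epsilon>"
begin

definition rayleigh_quotient :: "nat \<Rightarrow> real"
  where "rayleigh_quotient i = v i \<bullet> (H *v v i)"

text \<open>The matrix of the iteration acting on a vector, with the step parameter
  \<open>3 / 2 * \<mu>\<close> inserted.\<close>

definition reflect :: "real ^ 'n \<Rightarrow> real ^ 'n"
  where "reflect g = g - (\<Sum>i=1..k. ((1 + 3 / 2 * \<mu> / \<bar>rayleigh_quotient i\<bar>) * (v i \<bullet> g)) *\<^sub>R v i)"

definition exact_reflect :: "real ^ 'n \<Rightarrow> real ^ 'n"
  where "exact_reflect g = g - (\<Sum>i=1..k. ((1 + 3 / 2 * \<mu> / \<bar>lam i\<bar>) * (u i \<bullet> g)) *\<^sub>R u i)"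

lemma k_le: "k \<le> CARD('n)"
  using v by (rule orthonormal_upto_le_CARD)

lemma u_k: "orthonormal_upto k u"
  using u k_le by (rule orthonormal_upto_mono)

lemma inner_H: "i \<in> {1..CARD('n)} \<Longrightarrow> u i \<bullet> (H *v y) = lam i * (u i \<bullet> y)"
proof -
  assume i: "i \<in> {1..CARD('n)}"
  have "H *v y = H *v (\<Sum>j=1..CARD('n). (u j \<bullet> y) *\<^sub>R u j)"
    unfolding orthonormal_expansion[OF u] ..
  also have "\<dots> = (\<Sum>j=1..CARD('n). H *v ((u j \<bullet> y) *\<^sub>R u j))"
    by (rule linear_sum[OF matrix_vector_mul_linear])
  also have "\<dots> = (\<Sum>j=1..CARD('n). (lam j * (u j \<bullet> y)) *\<^sub>R u j)"
    using eigenvector by (intro sum.cong) (auto simp: matrix_vector_mult_scaleR mult.commute)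
  finally show ?thesis
    using inner_sum_orthonormal[OF u i] by simp
qed

text \<open>An operator that is diagonal in an orthonormal basis is symmetric. This removes the
  transpose from the gradient expansion with no appeal to equality of mixed partial
  derivatives.\<close>

lemma transpose_H: "transpose H *v y = H *v y"
proof -
  have "u i \<bullet> (transpose H *v y) = u i \<bullet> (H *v y)" if i: "i \<in> {1..CARD('n)}" for i
  proof -
    have "u i \<bullet> (transpose H *v y) = y \<bullet> (H *v u i)"
      unfolding transpose_matrix_vector inner_commute[of "u i"] by (rule dot_lmul_matrix)
    also have "\<dots> = u i \<bullet> (H *v y)"
      using eigenvector[OF i] inner_H[OF i] by (simp add: inner_commute)
    finally show ?thesis .
  qed
  then have "(\<Sum>i=1..CARD('n). (u i \<bullet> (transpose H *v y)) *\<^sub>R u i) =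
      (\<Sum>i=1..CARD('n). (u i \<bullet> (H *v y)) *\<^sub>R u i)"
    by (intro sum.cong) auto
  then show ?thesis
    unfolding orthonormal_expansion[OF u] .
qed

lemma abs_lam_le: "i \<in> {1..CARD('n)} \<Longrightarrow> \<bar>lam i\<bar> \<le> L"
  using lam_neg[of i] lam_pos[of i] const by (cases "i \<le> k") auto

lemma norm_H_le: "norm (H *v y) \<le> L * norm y"
proof -
  have "L2_set (\<lambda>i. u i \<bullet> (H *v y)) {1..CARD('n)} \<le> L * L2_set (\<lambda>i. u i \<bullet> y) {1..CARD('n)}"
    using const by (intro L2_set_scaled_le) (auto simp: inner_H abs_mult abs_lam_le mult_right_mono)
  then show ?thesis
    unfolding parseval[OF u, symmetric] .
qed

text \<open>The first-order term disappears: since \<open>u i\<close> and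
  \<open>v i = u i + w\<close> are unit vectors,
  \<open>2 * (u i \<bullet> w) = - (norm w)\<^sup>2\<close>, and only two quadratic terms of size
  \<open>L * \<alpha>\<^sup>2\<close> remain.\<close>

lemma rayleigh_close:
  assumes i: "i \<in> {1..k}"
  shows "\<bar>rayleigh_quotient i - lam i\<bar> \<le> 2 * L * \<alpha>\<^sup>2"
proof -
  define w where "w = v i - u i"
  have i': "i \<in> {1..CARD('n)}"
    using i k_le by auto
  have unit: "u i \<bullet> u i = 1" "v i \<bullet> v i = 1"
    using u v i i' by (auto simp: orthonormal_upto_def)
  have v_eq: "v i = u i + w"
    by (simp add: w_def)
  have "norm w \<le> \<alpha> / sqrt (real k)"
    using error[OF i] by (simp add: w_def norm_minus_commute)
  also have "\<dots> \<le> \<alpha> / 1"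
    using i alpha by (intro divide_left_mono) auto
  finally have w: "(norm w)\<^sup>2 \<le> \<alpha>\<^sup>2"
    by (simp add: power_mono)
  have "2 * (u i \<bullet> w) = - (norm w)\<^sup>2"
    using unit unfolding v_eq power2_norm_eq_inner by (simp add: inner_add inner_commute)
  moreover have "rayleigh_quotient i = lam i + lam i * (2 * (u i \<bullet> w)) + w \<bullet> (H *v w)"
    unfolding rayleigh_quotient_def v_eq using unit(1) i'
    by (simp add: matrix_vector_right_distrib inner_add inner_H eigenvector inner_commute[of w] distrib_left)
  ultimately have "rayleigh_quotient i - lam i = w \<bullet> (H *v w) - lam i * (norm w)\<^sup>2"
    by simp
  moreover have "\<bar>w \<bullet> (H *v w)\<bar> \<le> L * (norm w)\<^sup>2"
  proof -
    have "\<bar>w \<bullet> (H *v w)\<bar> \<le> norm w * norm (H *v w)"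
      by (rule Cauchy_Schwarz_ineq2)
    also have "\<dots> \<le> norm w * (L * norm w)"
      by (intro mult_left_mono norm_H_le) simp
    finally show ?thesis
      by (simp add: power2_eq_square mult_ac)
  qed
  moreover have "\<bar>lam i * (norm w)\<^sup>2\<bar> \<le> L * (norm w)\<^sup>2"
    using abs_lam_le[OF i'] by (simp add: abs_mult mult_right_mono)
  moreover have "L * (norm w)\<^sup>2 \<le> L * \<alpha>\<^sup>2"
    using w const by (intro mult_left_mono) auto
  ultimately show ?thesis
    by linarith
qed

text \<open>Smallness of \<open>\<alpha>\<close> gives
  \<open>729 * (L * \<alpha>\<^sup>2) \<le> 4 * \<epsilon>\<close>, so the Rayleigh quotient moves
  by at most \<open>\<epsilon> / 4\<close> from an eigenvalue below \<open>-\<epsilon>\<close> or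
  equal to it.\<close>

lemma abs_rayleigh_ge:
  assumes i: "i \<in> {1..k}"
  shows "3 / 4 * \<epsilon> \<le> \<bar>rayleigh_quotient i\<bar>"
proof -
  have "27 * (\<epsilon> * \<alpha>) \<le> 2 * \<epsilon>"
    using alpha_small mult_right_mono[of \<epsilon> L \<alpha>] const alpha by linarith
  then have "27 * \<alpha> \<le> 2"
    using const by simp
  have "(27 * (L * \<alpha>)) * (27 * \<alpha>) \<le> (2 * \<epsilon>) * 2"
    by (rule mult_mono) (use \<open>27 * \<alpha> \<le> 2\<close> alpha_small const alpha in auto)
  also have "(27 * (L * \<alpha>)) * (27 * \<alpha>) = 729 * (L * \<alpha>\<^sup>2)"
    by (simp add: power2_eq_square)
  finally have "2 * L * \<alpha>\<^sup>2 \<le> \<epsilon> / 4"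
    using const by linarith
  then show ?thesis
    using rayleigh_close[OF i] lam_neg[OF i] by auto
qed

lemma weight_le:
  assumes i: "i \<in> {1..k}"
  shows "3 / 2 * \<mu> / \<bar>rayleigh_quotient i\<bar> \<le> 2 * \<mu> / \<epsilon>"
proof -
  have "3 / 2 * \<mu> / \<bar>rayleigh_quotient i\<bar> \<le> 3 / 2 * \<mu> / (3 / 4 * \<epsilon>)"
    using abs_rayleigh_ge[OF i] const by (intro divide_left_mono) auto
  then show ?thesis
    by simp
qed

text \<open>The \<open>1\<close> in each weight is kept with the identity, since together they form
  an orthogonal projection of norm at most \<open>1\<close>. The rest costs
  \<open>2 * \<mu> / \<epsilon>\<close>, and \<open>1 \<le> \<mu> / \<epsilon>\<close> merges the
  two.\<close>

lemma norm_reflect_le: "norm (reflect d) \<le> 3 * \<mu> / \<epsilon> * norm d"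
proof -
  have "norm (\<Sum>i=1..k. (3 / 2 * \<mu> / \<bar>rayleigh_quotient i\<bar> * (v i \<bullet> d)) *\<^sub>R v i)
      \<le> 2 * \<mu> / \<epsilon> * L2_set (\<lambda>i. v i \<bullet> d) {1..k}"
  proof (rule norm_sum_orthonormal_le[OF v])
    fix i assume "i \<in> {1..k}"
    then have "3 / 2 * \<mu> / \<bar>rayleigh_quotient i\<bar> * \<bar>v i \<bullet> d\<bar> \<le> 2 * \<mu> / \<epsilon> * \<bar>v i \<bullet> d\<bar>"
      by (intro mult_right_mono weight_le) auto
    then show "\<bar>3 / 2 * \<mu> / \<bar>rayleigh_quotient i\<bar> * (v i \<bullet> d)\<bar> \<le> 2 * \<mu> / \<epsilon> * \<bar>v i \<bullet> d\<bar>"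
      using const by (simp add: abs_mult)
  qed (use const in simp)
  also have "\<dots> \<le> 2 * \<mu> / \<epsilon> * norm d"
    using bessel_inequality[OF v] const by (intro mult_left_mono) auto
  finally have "norm (\<Sum>i=1..k. (3 / 2 * \<mu> / \<bar>rayleigh_quotient i\<bar> * (v i \<bullet> d)) *\<^sub>R v i) \<le> 2 * \<mu> / \<epsilon> * norm d" .
  moreover have "reflect d = (d - (\<Sum>i=1..k. (v i \<bullet> d) *\<^sub>R v i))
      - (\<Sum>i=1..k. (3 / 2 * \<mu> / \<bar>rayleigh_quotient i\<bar> * (v i \<bullet> d)) *\<^sub>R v i)"
    by (simp add: reflect_def algebra_simps sum.distrib)
  ultimately have "norm (reflect d) \<le> norm d + 2 * \<mu> / \<epsilon> * norm d"
    using norm_diff_orthonormal_projection_le[OF v, of d] norm_triangle_ineq4 by (smt (verit))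
  moreover have "norm d \<le> \<mu> / \<epsilon> * norm d"
    using const by (simp add: mult_right_mono[of 1 "\<mu> / \<epsilon>", simplified])
  ultimately show ?thesis
    by simp
qed

text \<open>The exchange is made in two stages: first \<open>v\<close> becomes \<open>u\<close> with
  the weights \<open>a\<close> kept, then the weights become \<open>a0\<close>.\<close>

lemma reflect_diff_le:
  "norm (reflect (H *v e) - exact_reflect (H *v e))
    \<le> (2 * (1 + 2 * \<mu> / \<epsilon>) * \<alpha> * L + 4 * \<mu> / \<epsilon> * \<alpha>\<^sup>2 * L) * norm e"
proof -
  define h where "h = H *v e"
  define a where "a i = 1 + 3 / 2 * \<mu> / \<bar>rayleigh_quotient i\<bar>" for i
  define a0 where "a0 i = 1 + 3 / 2 * \<mu> / \<bar>lam i\<bar>" for i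
  define S where "S c w = (\<Sum>i=1..k. (c i * (w i \<bullet> h)) *\<^sub>R w i)" for c and w :: "nat \<Rightarrow> real ^ 'n"
  have "norm (S a v - S a u) \<le> 2 * (1 + 2 * \<mu> / \<epsilon>) * \<alpha> * norm h"
    unfolding S_def a_def using error const alpha weight_le
    by (intro norm_weighted_projection_diff_le[OF u_k v]) auto
  also have "\<dots> \<le> 2 * (1 + 2 * \<mu> / \<epsilon>) * \<alpha> * (L * norm e)"
    unfolding h_def using const alpha by (intro mult_left_mono norm_H_le) auto
  finally have 1: "norm (S a v - S a u) \<le> 2 * (1 + 2 * \<mu> / \<epsilon>) * \<alpha> * L * norm e"
    by (simp add: mult_ac)
  have coeff: "\<bar>(a i - a0 i) * (u i \<bullet> h)\<bar> \<le> 4 * \<mu> / \<epsilon> * \<alpha>\<^sup>2 * L * \<bar>u i \<bullet> e\<bar>" if i: "i \<in> {1..k}" for i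
  proof -
    have nz: "\<bar>lam i\<bar> \<noteq> 0" "\<bar>rayleigh_quotient i\<bar> \<noteq> 0"
      using lam_neg[OF i] abs_rayleigh_ge[OF i] const by auto
    \<comment> \<open>The factor \<open>\<bar>lam i\<bar>\<close> comes from
      \<open>u i \<bullet> h = lam i * (u i \<bullet> e)\<close>. It cancels the denominator of
      \<open>a0 i\<close>, which saves one factor \<open>1 / \<epsilon>\<close>.\<close>
    have "(a i - a0 i) * \<bar>lam i\<bar> = 3 / 2 * \<mu> / \<bar>rayleigh_quotient i\<bar> * (\<bar>lam i\<bar> - \<bar>rayleigh_quotient i\<bar>)"
      using nz unfolding a_def a0_def by (simp add: field_simps)
    then have "\<bar>(a i - a0 i) * \<bar>lam i\<bar>\<bar> = 3 / 2 * \<mu> / \<bar>rayleigh_quotient i\<bar> * \<bar>\<bar>lam i\<bar> - \<bar>rayleigh_quotient i\<bar>\<bar>"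
      using const by (simp only: abs_mult) simp
    moreover have "\<bar>\<bar>lam i\<bar> - \<bar>rayleigh_quotient i\<bar>\<bar> \<le> 2 * L * \<alpha>\<^sup>2"
      using rayleigh_close[OF i] by linarith
    ultimately have "\<bar>(a i - a0 i) * \<bar>lam i\<bar>\<bar> \<le> (2 * \<mu> / \<epsilon>) * (2 * L * \<alpha>\<^sup>2)"
      using weight_le[OF i] const by (simp only:) (intro mult_mono, auto)
    then have "\<bar>(a i - a0 i) * \<bar>lam i\<bar>\<bar> * \<bar>u i \<bullet> e\<bar> \<le> (2 * \<mu> / \<epsilon>) * (2 * L * \<alpha>\<^sup>2) * \<bar>u i \<bullet> e\<bar>"
      by (rule mult_right_mono) simp
    moreover have "u i \<bullet> h = lam i * (u i \<bullet> e)"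
      unfolding h_def using i k_le by (intro inner_H) auto
    ultimately show ?thesis
      by (simp add: abs_mult mult_ac)
  qed
  have "norm (\<Sum>i=1..k. ((a i - a0 i) * (u i \<bullet> h)) *\<^sub>R u i)
      \<le> 4 * \<mu> / \<epsilon> * \<alpha>\<^sup>2 * L * L2_set (\<lambda>i. u i \<bullet> e) {1..k}"
    using const by (intro norm_sum_orthonormal_le[OF u_k coeff]) auto
  also have "\<dots> \<le> 4 * \<mu> / \<epsilon> * \<alpha>\<^sup>2 * L * norm e"
    using bessel_inequality[OF u_k] const by (intro mult_left_mono) auto
  finally have 2: "norm (S a u - S a0 u) \<le> 4 * \<mu> / \<epsilon> * \<alpha>\<^sup>2 * L * norm e"
    unfolding S_def by (simp add: algebra_simps sum_subtractf)
  have "reflect h - exact_reflect h = - ((S a v - S a u) + (S a u - S a0 u))"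
    by (simp add: reflect_def exact_reflect_def S_def a_def a0_def)
  then have "norm (reflect h - exact_reflect h) = norm ((S a v - S a u) + (S a u - S a0 u))"
    by (simp only: norm_minus_cancel)
  also have "\<dots> \<le> 2 * (1 + 2 * \<mu> / \<epsilon>) * \<alpha> * L * norm e + 4 * \<mu> / \<epsilon> * \<alpha>\<^sup>2 * L * norm e"
    by (rule norm_triangle_mono[OF 1 2])
  finally show ?thesis
    unfolding h_def by (simp add: distrib_right)
qed

lemma exact_contraction:
  assumes \<rho>: "\<And>t. t = 3 / 2 * \<mu> \<or> \<mu> \<le> t \<and> t \<le> L \<Longrightarrow> \<bar>1 - \<beta> * t\<bar> \<le> \<rho>"
  shows "norm (e - \<beta> *\<^sub>R exact_reflect (H *v e)) \<le> \<rho> * norm e"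
proof -
  let ?y = "e - \<beta> *\<^sub>R exact_reflect (H *v e)"
  have "\<bar>u i \<bullet> ?y\<bar> \<le> \<rho> * \<bar>u i \<bullet> e\<bar>" if i: "i \<in> {1..CARD('n)}" for i
  proof -
    define t where "t = (if i \<le> k then 3 / 2 * \<mu> else lam i)"
    \<comment> \<open>For \<open>i \<le> k\<close> the factor is
      \<open>lam i - (1 + 3 / 2 * \<mu> / \<bar>lam i\<bar>) * lam i\<close>, which equals
      \<open>3 / 2 * \<mu>\<close> because \<open>lam i\<close> is negative.\<close>
    have "u i \<bullet> exact_reflect (H *v e) = t * (u i \<bullet> e)"
    proof (cases "i \<le> k")
      case True
      then have "lam i < 0"
        using lam_neg[of i] i const by auto
      then show ?thesis
        using True i unfolding exact_reflect_def inner_diff_right inner_partial_sum_orthonormal[OF u k_le i] t_def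
        by (simp add: inner_H field_simps)
    next
      case False
      then show ?thesis
        using i unfolding exact_reflect_def inner_diff_right inner_partial_sum_orthonormal[OF u k_le i] t_def
        by (simp add: inner_H)
    qed
    then have "u i \<bullet> ?y = (1 - \<beta> * t) * (u i \<bullet> e)"
      by (simp add: inner_diff_right algebra_simps)
    moreover have "\<bar>1 - \<beta> * t\<bar> \<le> \<rho>"
      using lam_pos[of i] i by (intro \<rho>) (auto simp: t_def)
    ultimately show ?thesis
      by (simp add: abs_mult mult_right_mono)
  qed
  moreover have "0 \<le> \<rho>"
    using \<rho>[of \<mu>] const by linarith
  ultimately have "L2_set (\<lambda>i. u i \<bullet> ?y) {1..CARD('n)} \<le> \<rho> * L2_set (\<lambda>i. u i \<bullet> e) {1..CARD('n)}"
    by (rule L2_set_scaled_le)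
  then show ?thesis
    unfolding parseval[OF u, symmetric] .
qed

text \<open>Here \<open>d\<close> stands for the remainder of the gradient expansion. The step
  splits into exact contraction, eigenvector error and remainder; the term \<open>4 / b * D\<close>
  of the first cancels the bound on the second.\<close>

lemma step_bound:
  defines "b \<equiv> rate_b \<mu> L \<alpha>"
  shows "norm (e - (4 / b) *\<^sub>R reflect (H *v e + d))
    \<le> (1 - rate_q \<epsilon> \<mu> L \<alpha>) * norm e + 12 * \<mu> / (b * \<epsilon>) * norm d"
proof -
  have b: "0 < b"
    unfolding b_def by (rule rate_b_pos) (use const alpha in auto)
  define D where "D = 2 * (1 + 2 * \<mu> / \<epsilon>) * \<alpha> * L + 4 * \<mu> / \<epsilon> * \<alpha>\<^sup>2 * L"
  let ?h = "H *v e"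
  have "reflect (?h + d) = reflect ?h + reflect d"
    by (simp add: reflect_def inner_add_right distrib_left scaleR_add_left sum.distrib del: times_divide_eq_left)
  then have split: "e - (4 / b) *\<^sub>R reflect (?h + d) = (e - (4 / b) *\<^sub>R exact_reflect ?h)
      - (4 / b) *\<^sub>R (reflect ?h - exact_reflect ?h) - (4 / b) *\<^sub>R reflect d"
    by (simp add: algebra_simps)
  have 1: "norm (e - (4 / b) *\<^sub>R exact_reflect ?h) \<le> (1 - rate_q \<epsilon> \<mu> L \<alpha> - 4 / b * D) * norm e"
    unfolding D_def b_def using const alpha
    by (intro exact_contraction contraction_factor_le) auto
  have 2: "norm ((4 / b) *\<^sub>R (reflect ?h - exact_reflect ?h)) \<le> 4 / b * (D * norm e)"
    using mult_left_mono[OF reflect_diff_le[of e], of "4 / b"] b by (simp add: D_def)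
  have 3: "norm ((4 / b) *\<^sub>R reflect d) \<le> 4 / b * (3 * \<mu> / \<epsilon> * norm d)"
    using mult_left_mono[OF norm_reflect_le[of d], of "4 / b"] b by simp
  have "norm (e - (4 / b) *\<^sub>R reflect (?h + d)) \<le> (1 - rate_q \<epsilon> \<mu> L \<alpha> - 4 / b * D) * norm e
      + 4 / b * (D * norm e) + 4 / b * (3 * \<mu> / \<epsilon> * norm d)"
    unfolding split by (intro order_trans[OF norm_triangle_ineq4] add_mono 1 2 3)
  then show ?thesis
    by (simp add: algebra_simps)
qed

end

section \<open>The scalar recursion\<close>

text \<open>The substitution \<open>1 / r n - c / q\<close> turns the recursion into linear growth by the factor
  \<open>1 + q\<close>; in the proof it is stated with the denominators cleared so that \<open>r n = 0\<close> is allowed.\<close>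

lemma quadratic_recursion_rate:
  fixes r :: "nat \<Rightarrow> real" and q c :: real
  defines "R \<equiv> q / c"
  assumes q: "0 < q" and c: "0 < c" and nonneg: "\<And>n. 0 \<le> r n" and r0: "r 0 < R"
    and rec: "\<And>n. r n \<le> r 0 \<Longrightarrow> r (Suc n) \<le> (1 - q + c * r n) * r n"
  shows "r n \<le> (1 / (1 + q)) ^ n * (R * r 0 / (R - r 0))"
proof -
  have cR: "c * R = q"
    using c by (simp add: R_def)
  \<comment> \<open>The recursion is available only while \<open>r n \<le> r 0\<close>, so this has
    to be secured first: there \<open>c * r n \<le> q\<close>, and the factor is at most
    \<open>1\<close>.\<close>
  have le: "r n \<le> r 0" for n
  proof (induction n)
    case (Suc n)
    have "c * r n \<le> c * R"
      using Suc r0 c by (intro mult_left_mono) auto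
    then have "(1 - q + c * r n) * r n \<le> 1 * r n"
      using cR nonneg by (intro mult_right_mono) auto
    then show ?case
      using rec[OF Suc] Suc by linarith
  qed simp
  have main: "(1 + q) ^ n * (R - r 0) * r n \<le> r 0 * (R - r n)" for n
  proof (induction n)
    case 0
    show ?case by (simp add: mult.commute)
  next
    case (Suc n)
    \<comment> \<open>As \<open>c * R = q\<close>, the contraction factor is exactly
      \<open>1 - y\<close>.\<close>
    define s t y where "s = r n" and "t = r (Suc n)" and "y = c * (R - s)"
    have st: "0 \<le> s" "0 \<le> t" "s < R"
      using nonneg le[of n] r0 by (auto simp: s_def t_def)
    have t: "t \<le> (1 - y) * s"
      using rec[OF le[of n]] cR by (simp add: s_def t_def y_def algebra_simps)
    show ?case
    proof (cases "s = 0")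
      case True
      then have "t = 0"
        using t st by simp
      then show ?thesis
        using nonneg[of 0] r0 by (simp add: t_def)
    next
      case False
      have "0 \<le> y"
        using st c by (simp add: y_def)
      \<comment> \<open>The bound \<open>(1 - y) * (1 + y) \<le> 1\<close> replaces
        \<open>1 - y\<close> by \<open>1 / (1 + y)\<close>, whatever the sign of
        \<open>1 - y\<close>.\<close>
      have "t * (1 + y) \<le> (1 - y) * s * (1 + y)"
        using t \<open>0 \<le> y\<close> by (intro mult_right_mono) auto
      also have "\<dots> = s - y\<^sup>2 * s"
        by (simp add: power2_eq_square algebra_simps)
      also have "\<dots> \<le> s"
        using st by simp
      finally have "R * (t * (1 + y)) \<le> R * s"
        using st by (intro mult_left_mono) auto
      also have "R * (t * (1 + y)) = t * (R + (c * R) * (R - s))"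
        by (simp add: y_def algebra_simps)
      finally have "(1 + q) * (t * (R - s)) \<le> s * (R - t)"
        unfolding cR by (simp add: algebra_simps)
      then have *: "r 0 * ((1 + q) * (t * (R - s))) \<le> r 0 * (s * (R - t))"
        using nonneg by (intro mult_left_mono) auto
      \<comment> \<open>The induction hypothesis, scaled so that its right side is the left side of
        \<open>*\<close>; chaining them leaves a common factor \<open>s > 0\<close> to
        cancel.\<close>
      have "(1 + q) * t * ((1 + q) ^ n * (R - r 0) * s) \<le> (1 + q) * t * (r 0 * (R - s))"
        using Suc q st unfolding s_def[symmetric] by (intro mult_left_mono) auto
      with * have "s * ((1 + q) ^ Suc n * (R - r 0) * t) \<le> s * (r 0 * (R - t))"
        by (simp add: mult_ac)
      then show ?thesis
        using False st by (simp add: t_def)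
    qed
  qed
  have "(1 + q) ^ n * (R - r 0) * r n \<le> R * r 0"
    using main[of n] mult_nonneg_nonneg[OF nonneg[of 0] nonneg[of n]]
    by (simp add: right_diff_distrib mult.commute)
  moreover have "0 < (1 + q) ^ n * (R - r 0)"
    using q r0 by simp
  ultimately have "r n \<le> R * r 0 / ((1 + q) ^ n * (R - r 0))"
    by (simp add: pos_le_divide_eq mult.commute)
  then show ?thesis
    by (simp add: power_one_over)
qed

section \<open>Convergence of the iteration to the saddle point\<close>

theorem theorem4p7:
  fixes E :: "real ^ 'n \<Rightarrow> real"
    and k :: nat
    and xs :: "real ^ 'n"
    and \<delta> M \<epsilon> \<mu> L \<alpha> :: real
    and x :: "nat \<Rightarrow> real ^ 'n"
    and \<beta> \<eta> :: "nat \<Rightarrow> real"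
    and v u :: "nat \<Rightarrow> nat \<Rightarrow> real ^ 'n"
    and ray :: "nat \<Rightarrow> nat \<Rightarrow> real"
  assumes smooth: "C_k 3 E"
    and saddle: "index_saddle k E xs"
    and delta: "0 < \<delta>"
    and M_pos: "0 < M"
    and hess_lipschitz: "\<And>y z. y \<in> ball xs \<delta> \<Longrightarrow> z \<in> ball xs \<delta> \<Longrightarrow>
          matrix_norm2 (hessian E y - hessian E z) \<le> M * norm (y - z)"
    and const_order: "0 < \<epsilon>" "\<epsilon> < \<mu>" "\<mu> < L"
    and neg_eigenvalues: "\<And>y i. y \<in> ball xs \<delta> \<Longrightarrow> i \<in> {1..k} \<Longrightarrow>
          nth_eigenvalue (hessian E y) i < 0 \<and> \<bar>nth_eigenvalue (hessian E y) i\<bar> \<in> {\<epsilon>..L}"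
    and pos_eigenvalues: "\<And>y i. y \<in> ball xs \<delta> \<Longrightarrow> i \<in> {k+1..CARD('n)} \<Longrightarrow>
          0 < nth_eigenvalue (hessian E y) i \<and> \<bar>nth_eigenvalue (hessian E y) i\<bar> \<in> {\<mu>..L}"
    and alpha: "\<alpha> \<in> {0<..<1}"
    and alpha_le: "\<alpha> \<le> sqrt (real k * \<epsilon> / (2 * (L + \<epsilon>)))"
    and alpha_kappa: "\<alpha> + L / \<mu> * (\<alpha> + 2 * rate_p \<epsilon> \<mu> \<alpha>) < 2"
    and beta: "\<And>n. \<beta> n = 4 / rate_b \<mu> L \<alpha>"
    and eta: "\<And>n. \<eta> n = 3 / 2 * \<mu>"
    and v_orthonormal: "\<And>n. orthonormal_upto k (v n)"
    and rayleigh: "\<And>n i. i \<in> {1..k} \<Longrightarrow> ray n i = v n i \<bullet> (hessian E (x n) *v v n i)"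
    and iteration: "\<And>n. x (Suc n) = x n - \<beta> n *\<^sub>R
          ((mat 1 - (\<Sum>i=1..k. (1 + \<eta> n / \<bar>ray n i\<bar>) *\<^sub>R outer_product (v n i) (v n i)))
             *v gradient E (x n))"
    and u_orthonormal: "\<And>n. orthonormal_upto CARD('n) (u n)"
    and u_eigenvector: "\<And>n i. i \<in> {1..CARD('n)} \<Longrightarrow>
          hessian E (x n) *v u n i = nth_eigenvalue (hessian E (x n)) i *\<^sub>R u n i"
    and eigenvector_error: "\<And>n i. i \<in> {1..k} \<Longrightarrow> norm (u n i - v n i) \<le> \<alpha> / sqrt (real k)"
    and initial: "norm (x 0 - xs) < min \<delta> (rate_radius M \<epsilon> \<mu> L \<alpha>)"
  shows "x \<longlonglongrightarrow> xs \<and>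
    (\<forall>n. norm (x n - xs) \<le> (1 / (1 + rate_q \<epsilon> \<mu> L \<alpha>)) ^ n *
       (rate_radius M \<epsilon> \<mu> L \<alpha> * norm (x 0 - xs) /
          (rate_radius M \<epsilon> \<mu> L \<alpha> - norm (x 0 - xs))))"
proof -
  define b q c R where "b = rate_b \<mu> L \<alpha>" and "q = rate_q \<epsilon> \<mu> L \<alpha>"
    and "c = rate_c M \<epsilon> \<mu> L \<alpha>" and "R = rate_radius M \<epsilon> \<mu> L \<alpha>"
  define r where "r n = norm (x n - xs)" for n
  have b: "0 < b"
    unfolding b_def by (rule rate_b_pos) (use alpha const_order in auto)
  have c: "0 < c"
    using M_pos const_order b unfolding c_def rate_c_def b_def by simp
  \<comment> \<open>The difference of the two sides is half the numerator of \<open>rate_q\<close>,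
    so this gives \<open>0 < q\<close>.\<close>
  have kappa: "\<alpha> * \<mu> + L * (\<alpha> + 2 * rate_p \<epsilon> \<mu> \<alpha>) < 2 * \<mu>"
  proof -
    have "(\<alpha> + L / \<mu> * (\<alpha> + 2 * rate_p \<epsilon> \<mu> \<alpha>)) * \<mu> < 2 * \<mu>"
      using alpha_kappa const_order by (intro mult_strict_right_mono) auto
    then show ?thesis
      using const_order by (simp add: distrib_right)
  qed
  have q: "0 < q"
    using kappa b unfolding q_def rate_q_def b_def
    by (intro divide_pos_pos) (auto simp: algebra_simps)
  have alpha_small: "27 * (L * \<alpha>) \<le> 2 * \<epsilon>"
  proof -
    \<comment> \<open>Only the term with \<open>27\<close> is kept; all others are
      nonnegative.\<close>
    have "\<alpha> + 2 * rate_p \<epsilon> \<mu> \<alpha> = 27 * \<mu> / \<epsilon> * \<alpha> + (6 * \<alpha> + (6 * \<mu> / \<epsilon> + 1) * \<alpha>\<^sup>2)"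
      by (simp add: rate_p_def algebra_simps)
    moreover have "0 \<le> 6 * \<alpha> + (6 * \<mu> / \<epsilon> + 1) * \<alpha>\<^sup>2"
      using alpha const_order by simp
    ultimately have "27 * \<mu> / \<epsilon> * \<alpha> \<le> \<alpha> + 2 * rate_p \<epsilon> \<mu> \<alpha>"
      by linarith
    then have "L * (27 * \<mu> / \<epsilon> * \<alpha>) \<le> L * (\<alpha> + 2 * rate_p \<epsilon> \<mu> \<alpha>)"
      using const_order by (intro mult_left_mono) auto
    moreover have "0 < \<alpha> * \<mu>"
      using alpha const_order by simp
    ultimately have "L * (27 * \<mu> / \<epsilon> * \<alpha>) \<le> 2 * \<mu>"
      using kappa by linarith
    then have "\<mu> * (27 * (L * \<alpha>)) \<le> \<mu> * (2 * \<epsilon>)"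
      using const_order by (simp add: field_simps)
    then show ?thesis
      using const_order by simp
  qed
  have diff: "partial_deriv j E differentiable (at y)" for j y
    using smooth by (simp add: numeral_eq_Suc differentiable_on_def)
  have rec: "r (Suc n) \<le> (1 - q + c * r n) * r n" if "r n \<le> r 0" for n
  proof -
    define H where "H = hessian E (x n)"
    define e where "e = x n - xs"
    define g where "g = gradient E (x n)"
    have ball: "x n \<in> ball xs \<delta>"
      using that initial by (simp add: r_def dist_norm norm_minus_commute)
    interpret approx_eigenframe H "u n" "v n" "nth_eigenvalue H" k \<epsilon> \<mu> L \<alpha>
    proof
      show "orthonormal_upto CARD('n) (u n)" "orthonormal_upto k (v n)"
        by (rule u_orthonormal v_orthonormal)+
      show "H *v u n i = nth_eigenvalue H i *\<^sub>R u n i" if "i \<in> {1..CARD('n)}" for i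
        unfolding H_def using that by (rule u_eigenvector)
      show "nth_eigenvalue H i \<in> {-L..-\<epsilon>}" if "i \<in> {1..k}" for i
        using neg_eigenvalues[OF ball that] by (auto simp: H_def)
      show "nth_eigenvalue H i \<in> {\<mu>..L}" if "i \<in> {k+1..CARD('n)}" for i
        using pos_eigenvalues[OF ball that] by (auto simp: H_def)
      show "norm (u n i - v n i) \<le> \<alpha> / sqrt (real k)" if "i \<in> {1..k}" for i
        using that by (rule eigenvector_error)
    qed (use const_order alpha alpha_small in auto)
    have "(mat 1 - (\<Sum>i=1..k. (1 + \<eta> n / \<bar>ray n i\<bar>) *\<^sub>R outer_product (v n i) (v n i))) *v g
        = reflect g"
    proof -
      have "(\<Sum>i=1..k. (1 + \<eta> n / \<bar>ray n i\<bar>) *\<^sub>R outer_product (v n i) (v n i)) *v g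
          = (\<Sum>i=1..k. ((1 + 3 / 2 * \<mu> / \<bar>rayleigh_quotient i\<bar>) * (v n i \<bullet> g)) *\<^sub>R v n i)"
        unfolding sum_matrix_vector_mult
      proof (rule sum.cong[OF refl])
        fix i assume "i \<in> {1..k}"
        then have "ray n i = rayleigh_quotient i"
          unfolding rayleigh_quotient_def unfolding H_def by (rule rayleigh)
        then show "((1 + \<eta> n / \<bar>ray n i\<bar>) *\<^sub>R outer_product (v n i) (v n i)) *v g
            = ((1 + 3 / 2 * \<mu> / \<bar>rayleigh_quotient i\<bar>) * (v n i \<bullet> g)) *\<^sub>R v n i"
          by (simp add: eta outer_product_vector flip: scaleR_matrix_vector_assoc)
      qed
      then show ?thesis
        by (simp add: reflect_def matrix_vector_mult_diff_rdistrib)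
    qed
    then have "x (Suc n) - xs = e - (4 / b) *\<^sub>R reflect (H *v e + (g - H *v e))"
      by (simp add: iteration beta b_def e_def g_def)
    then have "r (Suc n) \<le> (1 - q) * norm e + 12 * \<mu> / (b * \<epsilon>) * norm (g - H *v e)"
      using step_bound[of e "g - H *v e"] by (simp add: r_def b_def q_def)
    \<comment> \<open>The gradient vanishes at \<open>xs\<close>, and \<open>transpose_H\<close>
      drops the transpose. Multiplying by \<open>12 * \<mu> / (b * \<epsilon>)\<close> then produces
      exactly the constant \<open>c\<close>.\<close>
    moreover have "norm (g - H *v e) \<le> M / 2 * (norm e)\<^sup>2"
      using gradient_expansion_bound[OF diff hess_lipschitz ball] saddle transpose_H[of e]
      by (simp add: index_saddle_def H_def e_def g_def)
    then have "12 * \<mu> / (b * \<epsilon>) * norm (g - H *v e) \<le> 12 * \<mu> / (b * \<epsilon>) * (M / 2 * (norm e)\<^sup>2)"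
      using b const_order by (intro mult_left_mono) auto
    moreover have "12 * \<mu> / (b * \<epsilon>) * (M / 2 * (norm e)\<^sup>2) = c * (norm e)\<^sup>2"
      by (simp add: c_def rate_c_def b_def mult_ac)
    ultimately show ?thesis
      by (simp add: r_def e_def power2_eq_square algebra_simps)
  qed
  have "r 0 < q / c"
    using initial by (simp add: r_def q_def c_def rate_radius_def)
  then have rate: "r n \<le> (1 / (1 + q)) ^ n * (R * r 0 / (R - r 0))" for n
    using quadratic_recursion_rate[OF q c, of r n] rec
    by (simp add: r_def R_def q_def c_def rate_radius_def)
  have "(\<lambda>n. (1 / (1 + q)) ^ n * (R * r 0 / (R - r 0))) \<longlonglongrightarrow> 0"
    using q by (intro tendsto_mult_left_zero LIMSEQ_realpow_zero) auto
  then have "r \<longlonglongrightarrow> 0"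
    by (rule tendsto_sandwich[OF _ _ tendsto_const, rotated 2])
      (use rate in \<open>auto simp: r_def intro!: always_eventually\<close>)
  then have "x \<longlonglongrightarrow> xs"
    unfolding r_def by (simp add: LIM_zero_iff tendsto_norm_zero_iff)
  then show ?thesis
    using rate unfolding r_def q_def R_def by blast
qed

end
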